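(* Let $H$ be a complex Hilbert space, let $\Omega$ be a domain in $H$, and let $u\in\mathcal{PSH}(\Omega)\cap C^2(\Omega)$. Assume that there exists a proper closed subspace $E\subsetneq H$ such that \[ \mathrm{Ran}\bigl(D'D''u(a)\bigr)\subset E\qquad\text{for all }a\in\Omega . \] Then $u$ is maximal in $\Omega$.
   Context: The inner product of $H$ is linear in the first variable. $\mathrm{Ran}$ denotes the range of an operator. Plurisubharmonic: for $\Omega\subset H$ open, $\mathcal{PSH}(\Omega)$ is the set of upper semicontinuous $u:\Omega\to[-\infty,\infty)$, not identically $-\infty$ on any component of $\Omega$, such that $u(z)\le\frac1{2\pi}\int_0^{2\pi}u(z+e^{i\theta}h)\,d\theta$ whenever $z\in\Omega$, $h\in H$ and $z+\lambda h\in\Omega$ for all $|\lambda|\le1$. Levi form: for $u\in C^2(\Omega)$ with second real Fréchet differential $D^2u(a)$, $4D'D''u(a)(s,t)=D^2u(a)(s,t)+D^2u(a)(is,it)+iD^2u(a)(s,it)-iD^2u(a)(is,t)$; this form is identified with the bounded operator $D'D''u(a)$ on $H$ given by $\langle D'D''u(a)s,t\rangle=D'D''u(a)(s,t)$ (so $D'D''\|z\|^2=I$). For $u$ plurisubharmonic this operator is positive. Maximal: $G\Subset\Omega$ means $G$ is a bounded open set with $\overline G\subset\Omega$ (no compactness of $\overline G$). $u\in\mathcal{PSH}(\Omega)$ is maximal in $\Omega$ if for every bounded open $G\Subset\Omega$ and every $v\in\mathcal{PSH}(G)$ with $\limsup_{z\to\xi}v(z)\le u(\xi)$ for all $\xi\in\partial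 G$, one has $v\le u$ on $G$. *)

theory Defs
  imports "HOL-Analysis.Analysis"
begin

section \<open>Complex Hilbert spaces\<close>

text \<open>
  The distribution only has real inner product spaces. A complex Hilbert space is a complete
  real inner product space with a compatible complex scalar multiplication and a complex inner
  product, linear in the first variable, whose real part is the real inner product (so norm and
  topology are those of the class \<^class>\<open>real_inner\<close>).
\<close>

class chilbert_space = real_inner + complete_space +
  fixes scaleC :: "complex \<Rightarrow> 'a \<Rightarrow> 'a" (infixr \<open>*\<^sub>C\<close> 75)
    and cinner :: "'a \<Rightarrow> 'a \<Rightarrow> complex"
  assumes scaleC_add_right: "c *\<^sub>C (x + y) = c *\<^sub>C x + c *\<^sub>C y"
    and scaleC_add_left: "(c + d) *\<^sub>C x = c *\<^sub>C x + d *\<^sub>C x"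
    and scaleC_scaleC: "c *\<^sub>C (d *\<^sub>C x) = (c * d) *\<^sub>C x"
    and scaleR_scaleC: "r *\<^sub>R x = complex_of_real r *\<^sub>C x"
    and cinner_commute: "cinner x y = cnj (cinner y x)"
    and cinner_add_left: "cinner (x + y) z = cinner x z + cinner y z"
    and cinner_scaleC_left: "cinner (c *\<^sub>C x) y = c * cinner x y"
    and inner_eq_Re_cinner: "inner x y = Re (cinner x y)"

instantiation complex :: chilbert_space
begin

definition scaleC_complex :: "complex \<Rightarrow> complex \<Rightarrow> complex" where "scaleC_complex c x = c * x"
definition cinner_complex :: "complex \<Rightarrow> complex \<Rightarrow> complex" where "cinner_complex x y = x * cnj y"

instance
  by standard
    (auto simp: scaleC_complex_def cinner_complex_def algebra_simps inner_complex_def scaleR_conv_of_real)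

end

global_interpretation complex_vector: vector_space "scaleC :: complex \<Rightarrow> 'a \<Rightarrow> 'a :: chilbert_space"
  defines csubspace = complex_vector.subspace
proof unfold_locales
  fix x :: 'a
  show "1 *\<^sub>C x = x"
    using scaleR_scaleC[of 1 x] by simp
qed (simp_all add: scaleC_add_right scaleC_add_left scaleC_scaleC)


section \<open>Plurisubharmonic and maximal functions\<close>

text \<open>
  The integral of an extended real valued function as the difference of the integrals of its
  positive and negative parts (\<^const>\<open>e2ennreal\<close> sends negative numbers to 0). For functions
  bounded above, such as upper semicontinuous functions on a circle, it lies in
  \<open>[-\<infinity>, \<infinity>)\<close>, and no \<open>\<infinity> - \<infinity>\<close> occurs.
\<close>

definition ereal_integral :: "'b measure \<Rightarrow> ('b \<Rightarrow> ereal) \<Rightarrow> ereal" where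
  "ereal_integral M f =
     enn2ereal (\<integral>\<^sup>+ x. e2ennreal (f x) \<partial>M) - enn2ereal (\<integral>\<^sup>+ x. e2ennreal (- f x) \<partial>M)"

definition circle_mean :: "('a::chilbert_space \<Rightarrow> ereal) \<Rightarrow> 'a \<Rightarrow> 'a \<Rightarrow> ereal" where
  "circle_mean u z h =
     ereal (1 / (2 * pi)) *
     ereal_integral (restrict_space lborel {0..2 * pi}) (\<lambda>\<theta>. u (z + cis \<theta> *\<^sub>C h))"

definition usc_on :: "'a::topological_space set \<Rightarrow> ('a \<Rightarrow> ereal) \<Rightarrow> bool" where
  "usc_on \<Omega> u \<longleftrightarrow> (\<forall>c. openin (top_of_set \<Omega>) {z \<in> \<Omega>. u z < c})"

definition psh_on :: "'a::chilbert_space set \<Rightarrow> ('a \<Rightarrow> ereal) \<Rightarrow> bool" where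
  "psh_on \<Omega> u \<longleftrightarrow>
     (\<forall>z\<in>\<Omega>. u z < \<infinity>) \<and>
     usc_on \<Omega> u \<and>
     (\<forall>C\<in>components \<Omega>. \<exists>z\<in>C. u z \<noteq> -\<infinity>) \<and>
     (\<forall>z\<in>\<Omega>. \<forall>h. (\<forall>c. cmod c \<le> 1 \<longrightarrow> z + c *\<^sub>C h \<in> \<Omega>) \<longrightarrow> u z \<le> circle_mean u z h)"

definition maximal_psh_on :: "'a::chilbert_space set \<Rightarrow> ('a \<Rightarrow> ereal) \<Rightarrow> bool" where
  "maximal_psh_on \<Omega> u \<longleftrightarrow>
     psh_on \<Omega> u \<and>
     (\<forall>G v. open G \<and> bounded G \<and> closure G \<subseteq> \<Omega> \<and> psh_on G v \<and>
            (\<forall>\<xi>\<in>frontier G. Limsup (at \<xi> within G) v \<le> u \<xi>)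
        \<longrightarrow> (\<forall>z\<in>G. v z \<le> u z))"


section \<open>Second derivatives and the Levi form\<close>

text \<open>
  The real Frechet differential as an element of the Banach space of bounded linear maps, so
  that it can be differentiated again. It is meaningful only where \<open>f\<close> is differentiable.
\<close>

definition fderiv :: "('a::real_normed_vector \<Rightarrow> 'b::real_normed_vector) \<Rightarrow> 'a \<Rightarrow> 'a \<Rightarrow>\<^sub>L 'b" where
  "fderiv f a = Blinfun (frechet_derivative f (at a))"

definition C2_on :: "'a::real_normed_vector set \<Rightarrow> ('a \<Rightarrow> real) \<Rightarrow> bool" where
  "C2_on \<Omega> u \<longleftrightarrow>
     (\<forall>a\<in>\<Omega>. u differentiable (at a)) \<and>
     (\<forall>a\<in>\<Omega>. fderiv u differentiable (at a)) \<and>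
     continuous_on \<Omega> (fderiv (fderiv u))"

definition D2 :: "('a::real_normed_vector \<Rightarrow> real) \<Rightarrow> 'a \<Rightarrow> 'a \<Rightarrow> 'a \<Rightarrow> real" where
  "D2 u a s t = blinfun_apply (blinfun_apply (fderiv (fderiv u) a) s) t"

definition levi_form :: "('a::chilbert_space \<Rightarrow> real) \<Rightarrow> 'a \<Rightarrow> 'a \<Rightarrow> 'a \<Rightarrow> complex" where
  "levi_form u a s t =
     (complex_of_real (D2 u a s t) + complex_of_real (D2 u a (\<i> *\<^sub>C s) (\<i> *\<^sub>C t))
      + \<i> * complex_of_real (D2 u a s (\<i> *\<^sub>C t))
      - \<i> * complex_of_real (D2 u a (\<i> *\<^sub>C s) t)) / 4"

definition levi_op :: "('a::chilbert_space \<Rightarrow> real) \<Rightarrow> 'a \<Rightarrow> 'a \<Rightarrow> 'a" where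
  "levi_op u a s = (THE w. \<forall>t. cinner w t = levi_form u a s t)"

text \<open>
  By the Riesz representation theorem the description above always has a unique solution.
\<close>

lemma riesz_real:
  fixes f :: "'a::{real_inner, complete_space} \<Rightarrow> real"
  assumes "bounded_linear f"
  shows "\<exists>w. \<forall>x. inner w x = f x"
proof -
  interpret f: bounded_linear f by fact
  define F where "F x = inner x x - 2 * f x" for x
  obtain K where K: "\<And>x. norm (f x) \<le> norm x * K"
    using f.bounded by blast
  have lower: "- K\<^sup>2 \<le> F x" for x
  proof -
    have "f x \<le> norm x * K"
      using K[of x] by auto
    moreover have "0 \<le> (norm x - K)\<^sup>2" by simp
    moreover have "inner x x = (norm x)\<^sup>2"
      by (simp add: power2_norm_eq_inner)
    ultimately show ?thesis
      unfolding F_def by (auto simp: power2_diff algebra_simps)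
  qed
  define m where "m = Inf (range F)"
  have bdd: "bdd_below (range F)"
    using lower by (auto intro!: bdd_belowI)
  have mle: "m \<le> F x" for x
    unfolding m_def by (rule cInf_lower) (use bdd in auto)
  have "\<exists>x. F x < m + 1 / Suc n" for n
  proof -
    have "Inf (range F) < m + 1 / Suc n"
      unfolding m_def by simp
    then show ?thesis
      using bdd by (subst (asm) cInf_less_iff) auto
  qed
  then obtain X where X: "\<And>n. F (X n) < m + 1 / Suc n" by metis
  have par: "(norm (x - y))\<^sup>2 \<le> 2 * (F x + F y - 2 * m)" for x y
  proof -
    have "F ((1/2) *\<^sub>R (x + y)) = (inner x x + 2 * inner x y + inner y y) / 4 - f x - f y"
      unfolding F_def by (simp add: f.scaleR f.add inner_add_left inner_add_right inner_commute field_simps)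
    with mle[of "(1/2) *\<^sub>R (x + y)"] show ?thesis
      unfolding F_def power2_norm_eq_inner
      by (simp add: inner_diff_left inner_diff_right inner_commute field_simps)
  qed
  have "Cauchy X"
  proof (rule metric_CauchyI)
    fix e :: real assume "e > 0"
    then obtain N where N: "1 / Suc N < e\<^sup>2 / 4"
      using reals_Archimedean[of "e\<^sup>2 / 4"] by (auto simp: inverse_eq_divide)
    show "\<exists>M. \<forall>i\<ge>M. \<forall>j\<ge>M. dist (X i) (X j) < e"
    proof (intro exI allI impI)
      fix i j assume ij: "N \<le> i" "N \<le> j"
      have "1 / Suc i \<le> 1 / Suc N" "1 / Suc j \<le> 1 / Suc N"
        using ij by (auto simp: frac_le)
      then have "(norm (X i - X j))\<^sup>2 < e\<^sup>2"
        using par[of "X i" "X j"] X[of i] X[of j] N by argo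
      then show "dist (X i) (X j) < e"
        using \<open>e > 0\<close> by (simp add: dist_norm power_less_imp_less_base)
    qed
  qed
  then obtain w where w: "X \<longlonglongrightarrow> w"
    using Cauchy_convergent_iff convergent_def by blast
  have "(\<lambda>n. F (X n)) \<longlonglongrightarrow> F w"
    unfolding F_def by (intro tendsto_intros w f.tendsto)
  moreover have "(\<lambda>n. m + 1 / Suc n) \<longlonglongrightarrow> m + 0"
    by (intro tendsto_intros LIMSEQ_Suc[OF lim_1_over_n])
  ultimately have Fw: "F w \<le> m"
    using X by (intro LIMSEQ_le[of "\<lambda>n. F (X n)" "F w" "\<lambda>n. m + 1 / Suc n" m]) (auto intro: less_imp_le)
  have "inner w y = f y" for y
  proof -
    define c where "c = inner w y - f y"
    define q where "q = inner y y + 1"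
    have q: "q > 0"
      using inner_ge_zero[of y] unfolding q_def by linarith
    have *: "0 \<le> 2 * r * c + r\<^sup>2 * inner y y" for r
    proof -
      have "F (w + r *\<^sub>R y) = F w + 2 * r * c + r\<^sup>2 * inner y y"
        unfolding F_def c_def
        by (simp add: f.add f.scaleR inner_add_left inner_add_right inner_commute
            power2_eq_square algebra_simps)
      with mle[of "w + r *\<^sub>R y"] Fw show ?thesis by linarith
    qed
    have "0 \<le> q\<^sup>2 * (2 * (- c / q) * c + (- c / q)\<^sup>2 * inner y y)"
      by (intro mult_nonneg_nonneg *) simp
    also have "\<dots> = - (c\<^sup>2 * (q + 1))"
    proof -
      have "q\<^sup>2 * (2 * (- c / q) * c + (- c / q)\<^sup>2 * p) = - (c\<^sup>2 * (q + 1))" if "p = q - 1" for p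
        using q unfolding that by (simp add: field_simps power2_eq_square)
      then show ?thesis by (simp add: q_def)
    qed
    finally have "c\<^sup>2 * (q + 1) \<le> 0" by simp
    then have "c = 0"
      using q by (simp add: mult_le_0_iff)
    then show ?thesis by (simp add: c_def)
  qed
  then show ?thesis by blast
qed

lemma cinner_scaleC_right: "cinner x (c *\<^sub>C y) = cnj c * cinner x y"
  by (metis cinner_commute cinner_scaleC_left complex_cnj_mult)

lemma ii_scaleC_ii [simp]: "\<i> *\<^sub>C \<i> *\<^sub>C x = - (x::'a::chilbert_space)"
  using scaleR_scaleC[of "-1" x] by (simp add: scaleC_scaleC)

lemma Im_cinner: "Im (cinner x y) = inner x (\<i> *\<^sub>C y)"
  by (simp add: inner_eq_Re_cinner cinner_scaleC_right)

lemma bounded_linear_ii: "bounded_linear (\<lambda>x::'a::chilbert_space. \<i> *\<^sub>C x)"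
proof (rule bounded_linear_intro[where K = 1])
  show "\<i> *\<^sub>C (r *\<^sub>R x) = r *\<^sub>R (\<i> *\<^sub>C x)" for r and x :: 'a
    by (simp add: scaleR_scaleC scaleC_scaleC mult.commute)
  show "norm (\<i> *\<^sub>C x) \<le> norm x * 1" for x :: 'a
    by (simp add: norm_eq_sqrt_inner inner_eq_Re_cinner cinner_scaleC_right cinner_scaleC_left)
qed (rule scaleC_add_right)

lemma cinner_levi_op: "cinner (levi_op u a s) t = levi_form u a s t"
proof -
  have Re: "Re (levi_form u a s t) = (D2 u a s t + D2 u a (\<i> *\<^sub>C s) (\<i> *\<^sub>C t)) / 4" for t
    by (simp add: levi_form_def)
  have Im: "Im (levi_form u a s t) = Re (levi_form u a s (\<i> *\<^sub>C t))" for t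
    by (simp add: levi_form_def D2_def blinfun.minus_right)
  have "bounded_linear (\<lambda>t. Re (levi_form u a s t))"
    unfolding Re D2_def
    by (intro bounded_linear_intros bounded_linear_ii
          bounded_linear_compose[OF bounded_linear_divide])
  then obtain w where w: "\<And>t. inner w t = Re (levi_form u a s t)"
    using riesz_real by blast
  have ex: "\<forall>t. cinner w t = levi_form u a s t"
    by (auto simp: complex_eq_iff Im_cinner w Im simp flip: inner_eq_Re_cinner)
  moreover have "w' = w" if "\<forall>t. cinner w' t = levi_form u a s t" for w'
  proof -
    have "inner (w' - w) t = 0" for t
      using that ex inner_eq_Re_cinner[of w' t] inner_eq_Re_cinner[of w t]
      by (simp add: inner_diff_left)
    then show ?thesis by (metis inner_eq_zero_iff right_minus_eq)
  qed
  ultimately have "\<forall>t. cinner (levi_op u a s) t = levi_form u a s t"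
    unfolding levi_op_def by (rule theI)
  then show ?thesis by blast
qed

end

theory Submission
  imports Defs
begin

text \<open>
  Let \<open>e\<close> be a unit vector orthogonal to \<open>E\<close>. The Levi form of \<open>u\<close> vanishes on \<open>(e, e)\<close>, which
  says that the restriction of \<open>u\<close> to every complex line in direction \<open>e\<close> has zero Laplacian.
  Maximality is then the maximum principle for subharmonic minus harmonic functions of one
  complex variable, applied on the slices of \<open>G\<close> by these lines: the slice through a given point
  is bounded, its boundary lies in the boundary of \<open>G\<close>, and, unlike \<open>G\<close> itself, it is relatively
  compact.

  The maximum principle is proved directly, by perturbation. If \<open>v z\<^sub>0 > u z\<^sub>0\<close>, then for small
  \<open>\<epsilon> > 0\<close> the function \<open>v - u + \<epsilon> \<parallel>z - z\<^sub>0\<parallel>\<^sup>2\<close>, with \<open>v\<close> replaced by \<open>u\<close> on the boundary, attains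
  its maximum over the closed slice (\<open>usc_extension_by_boundary_values\<close>, \<open>usc_attains_max\<close>), and
  the maximum point \<open>z\<close> is in \<open>G\<close> because on the boundary the function is at most \<open>\<epsilon> R\<^sup>2\<close>, where \<open>R\<close>
  bounds the distance from \<open>z\<^sub>0\<close> on \<open>G\<close>. This is impossible by \<open>no_maximum_along_line\<close>: a maximum
  at \<open>z\<close> bounds \<open>v\<close> from above on small circles around \<open>z\<close> in terms of \<open>u\<close>. By the second order
  Taylor formula (\<open>second_order_taylor_upper\<close>) the mean of \<open>u\<close> over a circle of radius \<open>r\<close>
  exceeds \<open>u z\<close> by at most \<open>o(r\<^sup>2)\<close>, since the Laplacian vanishes, while the perturbation lowers the
  bound by \<open>\<epsilon> r\<^sup>2\<close> on average; so the mean of \<open>v\<close> is less than \<open>v z\<close>.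
\<close>

section \<open>Orthogonal complements of closed subspaces\<close>

text \<open>
  The classical projection argument: by the parallelogram law a minimizing sequence for the
  distance from a point \<open>x\<close> outside \<open>E\<close> is Cauchy, and the difference of \<open>x\<close> and its limit, the
  nearest point of \<open>E\<close>, is orthogonal to \<open>E\<close>.
\<close>

lemma exists_nonzero_orthogonal:
  fixes E :: "'a::{real_inner, complete_space} set"
  assumes "subspace E" "closed E" "E \<noteq> UNIV"
  obtains e where "e \<noteq> 0" "\<And>y. y \<in> E \<Longrightarrow> inner y e = 0"
proof -
  obtain x where x: "x \<notin> E" using assms by blast
  have "E \<noteq> {}" using subspace_0[OF assms(1)] by blast
  define d where "d = infdist x E"
  have d0: "d \<ge> 0" unfolding d_def by (rule infdist_nonneg)
  have d_le: "d \<le> norm (x - y)" if "y \<in> E" for y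
    using infdist_le[OF that, of x] by (simp add: d_def dist_norm)
  have "\<exists>y\<in>E. (norm (x - y))\<^sup>2 < d\<^sup>2 + 1 / Suc n" for n
  proof -
    have "d = sqrt (d\<^sup>2)" using d0 by simp
    also have "\<dots> < sqrt (d\<^sup>2 + 1 / Suc n)" by (rule real_sqrt_less_mono) simp
    finally have "Inf ((dist x) ` E) < sqrt (d\<^sup>2 + 1 / Suc n)"
      using \<open>E \<noteq> {}\<close> by (simp add: d_def infdist_def)
    then obtain y where "y \<in> E" "dist x y < sqrt (d\<^sup>2 + 1 / Suc n)"
      using \<open>E \<noteq> {}\<close> by (subst (asm) cInf_less_iff) auto
    moreover from this have "(dist x y)\<^sup>2 < (sqrt (d\<^sup>2 + 1 / Suc n))\<^sup>2"
      by (intro power_strict_mono) auto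
    ultimately show ?thesis
      by (intro bexI[of _ y]) (auto simp: dist_norm)
  qed
  then obtain Y where Y: "\<And>n. Y n \<in> E" "\<And>n. (norm (x - Y n))\<^sup>2 < d\<^sup>2 + 1 / Suc n" by metis
  \<comment> \<open>The parallelogram law for \<open>x - y\<close> and \<open>x - z\<close>; the midpoint of \<open>y\<close> and \<open>z\<close> is again in \<open>E\<close>.\<close>
  have par: "(norm (y - z))\<^sup>2 \<le> 2 * (norm (x - y))\<^sup>2 + 2 * (norm (x - z))\<^sup>2 - 4 * d\<^sup>2"
    if "y \<in> E" "z \<in> E" for y z
  proof -
    have "(1/2) *\<^sub>R (y + z) \<in> E"
      using assms(1) that by (intro subspace_scale subspace_add)
    then have "d\<^sup>2 \<le> (norm (x - (1/2) *\<^sub>R (y + z)))\<^sup>2"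
      using d0 by (intro power_mono d_le)
    then show ?thesis
      unfolding power2_norm_eq_inner
      by (simp add: inner_diff_left inner_diff_right inner_add_left inner_add_right
          inner_commute field_simps)
  qed
  have "Cauchy Y"
  proof (rule metric_CauchyI)
    fix r :: real assume "r > 0"
    then obtain N where N: "1 / Suc N < r\<^sup>2 / 4"
      using reals_Archimedean[of "r\<^sup>2 / 4"] by (auto simp: inverse_eq_divide)
    show "\<exists>M. \<forall>i\<ge>M. \<forall>j\<ge>M. dist (Y i) (Y j) < r"
    proof (intro exI allI impI)
      fix i j assume ij: "N \<le> i" "N \<le> j"
      have "1 / Suc i \<le> 1 / Suc N" "1 / Suc j \<le> 1 / Suc N"
        using ij by (auto simp: frac_le)
      then have "(norm (Y i - Y j))\<^sup>2 < r\<^sup>2"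
        using par[OF Y(1) Y(1), of i j] Y(2)[of i] Y(2)[of j] N by argo
      then show "dist (Y i) (Y j) < r"
        using \<open>r > 0\<close> by (simp add: dist_norm power_less_imp_less_base)
    qed
  qed
  then obtain p where p: "Y \<longlonglongrightarrow> p"
    using Cauchy_convergent_iff convergent_def by blast
  have "p \<in> E" using closed_sequentially[OF assms(2)] Y(1) p by blast
  have "(\<lambda>n. (norm (x - Y n))\<^sup>2) \<longlonglongrightarrow> (norm (x - p))\<^sup>2"
    by (intro tendsto_intros p)
  moreover have "(\<lambda>n. d\<^sup>2 + 1 / Suc n) \<longlonglongrightarrow> d\<^sup>2 + 0"
    by (intro tendsto_intros LIMSEQ_Suc[OF lim_1_over_n])
  ultimately have pd: "(norm (x - p))\<^sup>2 \<le> d\<^sup>2"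
    using Y(2) by (intro LIMSEQ_le[of "\<lambda>n. (norm (x - Y n))\<^sup>2" _ "\<lambda>n. d\<^sup>2 + 1 / Suc n"])
      (auto intro: less_imp_le)
  show thesis
  proof
    show "x - p \<noteq> 0" using x \<open>p \<in> E\<close> by auto
    fix y assume "y \<in> E"
    define c where "c = inner y (x - p)"
    have *: "2 * t * c \<le> t\<^sup>2 * inner y y" for t
    proof -
      have "p + t *\<^sub>R y \<in> E"
        using assms(1) \<open>p \<in> E\<close> \<open>y \<in> E\<close> by (intro subspace_add subspace_scale)
      then have "(norm (x - p))\<^sup>2 \<le> (norm (x - (p + t *\<^sub>R y)))\<^sup>2"
        using d0 by (intro order.trans[OF pd] power_mono d_le)
      then show ?thesis
        unfolding power2_norm_eq_inner c_def
        by (simp add: inner_diff_left inner_diff_right inner_add_left inner_add_right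
          inner_commute power2_eq_square algebra_simps)
    qed
    show "inner y (x - p) = 0"
    proof (cases "y = 0")
      case False
      then have q: "inner y y > 0" by simp
      \<comment> \<open>The value \<open>c / inner y y\<close> of \<open>t\<close> minimizes the distance from \<open>x\<close> to \<open>p + t *\<^sub>R y\<close>.\<close>
      have "2 * (c / inner y y) * c \<le> (c / inner y y)\<^sup>2 * inner y y" by (rule *)
      then have "2 * c\<^sup>2 \<le> c\<^sup>2"
        using q by (simp add: field_simps power2_eq_square)
      then show ?thesis by (simp add: c_def)
    qed simp
  qed
qed

section \<open>The second order Taylor formula\<close>

lemma has_derivative_fderiv:
  assumes "f differentiable (at a)"
  shows "(f has_derivative blinfun_apply (fderiv f a)) (at a)"
proof -
  have "(f has_derivative frechet_derivative f (at a)) (at a)"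
    using assms by (simp add: frechet_derivative_works)
  then show ?thesis
    unfolding fderiv_def by (simp add: bounded_linear_Blinfun_apply has_derivative_bounded_linear)
qed

text \<open>
  The Peano form of the remainder. The mean value theorem for
  \<open>t \<mapsto> u (a + t h) - t Du(a) h - t\<^sup>2/2 D\<^sup>2u(a)(h, h)\<close> on \<open>[0, 1]\<close> reduces it to the first order
  expansion of \<open>Du\<close> at \<open>a\<close>.
\<close>

lemma second_order_taylor_upper:
  fixes u :: "'a::real_normed_vector \<Rightarrow> real"
  assumes "open \<Omega>" "a \<in> \<Omega>" "C2_on \<Omega> u" "\<epsilon> > 0"
  obtains \<delta> where "\<delta> > 0"
    "\<And>h. norm h < \<delta> \<Longrightarrow> u (a + h) \<le> u a + fderiv u a h + D2 u a h h / 2 + \<epsilon> * (norm h)\<^sup>2"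
proof -
  have du: "\<And>x. x \<in> \<Omega> \<Longrightarrow> (u has_derivative blinfun_apply (fderiv u x)) (at x)"
    and ddu: "(fderiv u has_derivative blinfun_apply (fderiv (fderiv u) a)) (at a)"
    using assms has_derivative_fderiv unfolding C2_on_def by blast+
  obtain d1 where d1: "d1 > 0" "ball a d1 \<subseteq> \<Omega>"
    using assms open_contains_ball by blast
  obtain d2 where d2: "d2 > 0"
    "\<And>y. norm (y - a) < d2 \<Longrightarrow>
       norm (fderiv u y - fderiv u a - fderiv (fderiv u) a (y - a)) \<le> \<epsilon> * norm (y - a)"
    using ddu \<open>\<epsilon> > 0\<close> unfolding has_derivative_at_alt by blast
  show thesis
  proof
    show "min d1 d2 > 0" using d1 d2 by simp
    fix h :: 'a assume h: "norm h < min d1 d2"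
    define g where "g t = u (a + t *\<^sub>R h) - t * fderiv u a h - t\<^sup>2 / 2 * D2 u a h h" for t
    define g' where "g' t = fderiv u (a + t *\<^sub>R h) h - fderiv u a h - t * D2 u a h h" for t
    have th: "norm (t *\<^sub>R h) < min d1 d2" "t * norm h \<le> norm h" if "0 \<le> t" "t \<le> 1" for t
    proof -
      show *: "t * norm h \<le> norm h" using that by (simp add: mult_left_le_one_le)
      show "norm (t *\<^sub>R h) < min d1 d2"
        using that * h by simp
    qed
    have "(g has_real_derivative g' t) (at t)" if "0 \<le> t" "t \<le> 1" for t
    proof -
      have "a + t *\<^sub>R h \<in> \<Omega>"
        using th[OF that] d1 by (auto simp: subset_iff dist_norm)
      then have "((\<lambda>t. u (a + t *\<^sub>R h)) has_derivative (\<lambda>s. fderiv u (a + t *\<^sub>R h) (s *\<^sub>R h))) (at t)"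
        by (intro has_derivative_compose[of "\<lambda>t. a + t *\<^sub>R h", OF _ du])
           (auto intro!: derivative_eq_intros)
      then have "((\<lambda>t. u (a + t *\<^sub>R h)) has_real_derivative fderiv u (a + t *\<^sub>R h) h) (at t)"
        by (simp add: has_field_derivative_def blinfun.scaleR_right mult_commute_abs)
      then show ?thesis
        unfolding g_def g'_def by (auto intro!: derivative_eq_intros)
    qed
    then obtain t where t: "0 < t" "t < 1" "g 1 - g 0 = g' t"
      using MVT2[of 0 1 g g'] by auto
    have "g' t = (fderiv u (a + t *\<^sub>R h) - fderiv u a - fderiv (fderiv u) a (t *\<^sub>R h)) h"
      by (simp add: g'_def D2_def blinfun.diff_left blinfun.scaleR_left blinfun.scaleR_right)
    also have "\<dots> \<le> norm (fderiv u (a + t *\<^sub>R h) - fderiv u a - fderiv (fderiv u) a (t *\<^sub>R h)) * norm h"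
      using norm_blinfun[of "fderiv u (a + t *\<^sub>R h) - fderiv u a - fderiv (fderiv u) a (t *\<^sub>R h)" h]
      by (simp only: real_norm_def abs_le_iff)
    also have "\<dots> \<le> \<epsilon> * norm h * norm h"
    proof (rule mult_right_mono)
      have "norm (fderiv u (a + t *\<^sub>R h) - fderiv u a - fderiv (fderiv u) a (t *\<^sub>R h))
          \<le> \<epsilon> * norm (t *\<^sub>R h)"
        using d2(2)[of "a + t *\<^sub>R h"] th[of t] t by simp
      also have "\<dots> \<le> \<epsilon> * norm h"
        using th(2)[of t] t \<open>\<epsilon> > 0\<close> by (intro mult_left_mono) auto
      finally show "norm (fderiv u (a + t *\<^sub>R h) - fderiv u a - fderiv (fderiv u) a (t *\<^sub>R h))
          \<le> \<epsilon> * norm h" .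
    qed simp
    finally show "u (a + h) \<le> u a + fderiv u a h + D2 u a h h / 2 + \<epsilon> * (norm h)\<^sup>2"
      using t(3) by (simp add: g_def power2_eq_square algebra_simps)
  qed
qed

section \<open>Upper bounds for circle means\<close>

lemma ereal_integral_mono:
  assumes "\<And>x. x \<in> space M \<Longrightarrow> f x \<le> g x"
  shows "ereal_integral M f \<le> ereal_integral M g"
  unfolding ereal_integral_def
  by (intro ereal_minus_mono) (auto simp: less_eq_ennreal.rep_eq[symmetric] assms
      intro!: nn_integral_mono e2ennreal_mono)

lemma ereal_integral_real:
  assumes "integrable M f"
  shows "ereal_integral M (\<lambda>x. ereal (f x)) = ereal (integral\<^sup>L M f)"
proof -
  have fin: "(\<integral>\<^sup>+ x. ennreal (f x) \<partial>M) \<noteq> \<infinity>" "(\<integral>\<^sup>+ x. ennreal (- f x) \<partial>M) \<noteq> \<infinity>"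
    using assms by (auto simp: real_integrable_def)
  have *: "enn2ereal X = ereal (enn2real X)" if "X \<noteq> \<infinity>" for X
    using that by (cases X) auto
  show ?thesis
    using fin by (simp add: ereal_integral_def real_lebesgue_integral_def[OF assms] *)
qed

text \<open>
  A quadratic polynomial in \<open>h\<close>, evaluated at \<open>cis \<theta> *\<^sub>C h\<close>, is a trigonometric polynomial
  in \<open>\<theta>\<close> of degree 2, and only its constant term contributes to the mean.
\<close>

lemma circle_mean_le_trigonometric:
  assumes "\<And>\<theta>. f (z + cis \<theta> *\<^sub>C h)
             \<le> ereal (k + a * cos \<theta> + b * sin \<theta> + c * cos (2 * \<theta>) + d * sin (2 * \<theta>))"
  shows "circle_mean f z h \<le> ereal k"
proof -
  define T where "T \<theta> = k + a * cos \<theta> + b * sin \<theta> + c * cos (2 * \<theta>) + d * sin (2 * \<theta>)" for \<theta>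
  define F where "F \<theta> = k * \<theta> + a * sin \<theta> - b * cos \<theta> + c / 2 * sin (2 * \<theta>) - d / 2 * cos (2 * \<theta>)" for \<theta>
  let ?M = "restrict_space lborel {0..2 * pi}"
  have "has_bochner_integral lborel (\<lambda>\<theta>. indicator {0..2 * pi} \<theta> *\<^sub>R T \<theta>) (F (2 * pi) - F 0)"
    by (rule has_bochner_integral_FTC_Icc)
       (auto simp: F_def T_def simp flip: has_real_derivative_iff_has_vector_derivative
          intro!: derivative_eq_intros continuous_intros)
  moreover have "F (2 * pi) - F 0 = 2 * pi * k"
    using sin_2npi[of 2] cos_2npi[of 2] by (simp add: F_def mult.commute)
  ultimately have "has_bochner_integral ?M T (2 * pi * k)"
    by (simp add: has_bochner_integral_restrict_space)
  then have int: "integrable ?M T" "integral\<^sup>L ?M T = 2 * pi * k"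
    by (auto simp: has_bochner_integral_iff)
  have "ereal_integral ?M (\<lambda>\<theta>. f (z + cis \<theta> *\<^sub>C h)) \<le> ereal_integral ?M (\<lambda>\<theta>. ereal (T \<theta>))"
    using assms by (intro ereal_integral_mono) (simp add: T_def)
  also have "\<dots> = ereal (2 * pi * k)"
    using int by (simp add: ereal_integral_real)
  finally have "circle_mean f z h \<le> ereal (1 / (2 * pi)) * ereal (2 * pi * k)"
    unfolding circle_mean_def by (intro ereal_mult_left_mono) auto
  then show ?thesis by simp
qed

section \<open>Complex scalars in a Hilbert space\<close>

lemma cis_scaleC: "cis \<theta> *\<^sub>C h = cos \<theta> *\<^sub>R h + sin \<theta> *\<^sub>R (\<i> *\<^sub>C h)"
proof -
  have "cis \<theta> = complex_of_real (cos \<theta>) + complex_of_real (sin \<theta>) * \<i>"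
    by (simp add: complex_eq_iff)
  then show ?thesis
    by (simp only: scaleC_add_left scaleR_scaleC scaleC_scaleC)
qed

lemma norm_scaleC: "norm (c *\<^sub>C (x::'a::chilbert_space)) = cmod c * norm x"
proof -
  have "(norm (c *\<^sub>C x))\<^sup>2 = (cmod c * norm x)\<^sup>2"
    unfolding power_mult_distrib power2_norm_eq_inner[of "c *\<^sub>C x"] power2_norm_eq_inner[of x]
    by (simp add: inner_eq_Re_cinner cinner_scaleC_left cinner_scaleC_right cmod_power2
       flip: mult.assoc complex_mult_cnj) (simp add: power2_eq_square)
  then show ?thesis
    by simp
qed

section \<open>Upper semicontinuous functions\<close>

text \<open>
  If every value \<open>f x\<close> is exceeded by some \<open>f (b x)\<close>, the sets \<open>{f < f (b x)}\<close> form an open cover. For a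
  finite subcover, the point \<open>b x\<close> with the largest \<open>f (b x)\<close> would not be covered.
\<close>

lemma usc_attains_max:
  fixes f :: "'a::topological_space \<Rightarrow> 'b::linorder"
  assumes "compact K" "K \<noteq> {}"
    and usc: "\<And>x c. x \<in> K \<Longrightarrow> f x < c \<Longrightarrow> \<forall>\<^sub>F y in at x within K. f y < c"
  obtains x where "x \<in> K" "\<And>y. y \<in> K \<Longrightarrow> f y \<le> f x"
proof (rule ccontr)
  assume "\<not> thesis"
  with that have "\<exists>y\<in>K. f x < f y" if "x \<in> K" for x
    using \<open>x \<in> K\<close> by (meson linorder_not_less)
  then obtain b where b: "\<And>x. x \<in> K \<Longrightarrow> b x \<in> K \<and> f x < f (b x)" by metis
  have "\<exists>U. open U \<and> x \<in> U \<and> (\<forall>y\<in>U \<inter> K. f y < f (b x))" if "x \<in> K" for x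
  proof -
    have "\<forall>\<^sub>F y in at x within K. f y < f (b x)"
      using b[OF that] by (intro usc that) simp
    then obtain U where "open U" "x \<in> U" "\<And>y. y \<in> U \<Longrightarrow> y \<noteq> x \<Longrightarrow> y \<in> K \<Longrightarrow> f y < f (b x)"
      unfolding eventually_at_topological by auto
    then show ?thesis
      using b[OF that] by (intro exI[of _ U]) (metis IntE)
  qed
  then obtain U where U: "\<And>x. x \<in> K \<Longrightarrow> open (U x) \<and> x \<in> U x \<and> (\<forall>y\<in>U x \<inter> K. f y < f (b x))"
    by metis
  obtain C where C: "C \<subseteq> K" "finite C" "K \<subseteq> (\<Union>x\<in>C. U x)"
    using compactE_image[OF assms(1), of K U] U by blast
  then have "C \<noteq> {}" using assms by blast
  define m where "m = Max ((\<lambda>x. f (b x)) ` C)"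
  have "m \<in> (\<lambda>x. f (b x)) ` C" unfolding m_def using C \<open>C \<noteq> {}\<close> by (intro Max_in) auto
  then obtain x where x: "x \<in> C" "m = f (b x)" by blast
  then have "b x \<in> K" using b C by blast
  then obtain x' where "x' \<in> C" "b x \<in> U x'" using C by blast
  then have "f (b x) < f (b x')" using U C \<open>b x \<in> K\<close> by blast
  also have "\<dots> \<le> m" unfolding m_def using C \<open>x' \<in> C\<close> by (intro Max_ge) auto
  finally show False using x by simp
qed

lemma usc_on_eventually:
  assumes "usc_on \<Omega> u" "x \<in> \<Omega>" "u x < c"
  shows "\<forall>\<^sub>F y in at x within \<Omega>. u y < c"
proof -
  obtain T where "open T" "{z \<in> \<Omega>. u z < c} = \<Omega> \<inter> T"
    using assms(1) unfolding usc_on_def openin_open by blast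
  then show ?thesis
    using assms unfolding eventually_at_topological by blast
qed

text \<open>
  A bound on the boundary limsup of \<open>v\<close> by a continuous function \<open>u\<close> is used in this form:
  extending \<open>v\<close> by \<open>u\<close> to the boundary gives an upper semicontinuous function on the closure,
  which has maxima on compact sets.
\<close>

lemma usc_extension_by_boundary_values:
  fixes v :: "'a::topological_space \<Rightarrow> ereal" and u :: "'a \<Rightarrow> real"
  assumes G: "open G" and v: "usc_on G v" and cu: "continuous_on (closure G) u"
    and bd: "\<And>\<xi>. \<xi> \<in> frontier G \<Longrightarrow> Limsup (at \<xi> within G) v \<le> u \<xi>"
    and x: "x \<in> closure G" "(if x \<in> G then v x else ereal (u x)) < c"
  shows "\<forall>\<^sub>F y in at x within closure G. (if y \<in> G then v y else ereal (u y)) < c"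
proof (cases "x \<in> G")
  case True
  have "\<forall>\<^sub>F y in at x within G. v y < c"
    using usc_on_eventually[of G v x c] v True x by simp
  then have "\<forall>\<^sub>F y in at x. v y < c"
    unfolding at_within_open[OF True G] .
  moreover have "\<forall>\<^sub>F y in at x. y \<in> G"
    by (rule eventually_at_in_open'[OF G True])
  ultimately have "\<forall>\<^sub>F y in at x. (if y \<in> G then v y else ereal (u y)) < c"
    by eventually_elim simp
  then show ?thesis
    by (rule filter_leD[OF at_le[OF subset_UNIV]])
next
  case False
  have "x \<in> frontier G" using False x G by (simp add: frontier_def interior_open)
  then have "Limsup (at x within G) v < c"
    using bd[of x] x False by simp
  then have "\<forall>\<^sub>F y in at x within G. v y < c" by (rule Limsup_lessD)
  then have 1: "\<forall>\<^sub>F y in at x within closure G. y \<in> G \<longrightarrow> v y < c"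
    by (auto simp: eventually_at_filter elim: eventually_mono)
  have "((\<lambda>y. ereal (u y)) \<longlongrightarrow> ereal (u x)) (at x within closure G)"
    using cu x by (auto simp: continuous_on_def)
  then have "\<forall>\<^sub>F y in at x within closure G. ereal (u y) < c"
    using x False by (intro order_tendstoD(2)) auto
  with 1 show ?thesis
    by eventually_elim simp
qed

lemma eventually_add_continuous_less:
  fixes v :: "'a::topological_space \<Rightarrow> ereal"
  assumes "\<And>c. v x < c \<Longrightarrow> \<forall>\<^sub>F y in at x within S. v y < c"
    and "(g \<longlongrightarrow> g x) (at x within S)" and "v x + ereal (g x) < c"
  shows "\<forall>\<^sub>F y in at x within S. v y + ereal (g y) < c"
proof -
  have "v x < c - ereal (g x)"
    using assms(3) by (simp add: ereal_less_minus)
  then obtain d where d: "v x < ereal d" "ereal d < c - ereal (g x)"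
    by (metis ereal_dense2)
  have "ereal (d + g x) < c"
    using d(2) by (simp add: ereal_less_minus)
  moreover have "((\<lambda>y. ereal (d + g y)) \<longlongrightarrow> ereal (d + g x)) (at x within S)"
    by (intro tendsto_intros assms)
  ultimately have "\<forall>\<^sub>F y in at x within S. ereal (d + g y) < c"
    by (rule order_tendstoD(2)[rotated])
  with assms(1)[OF d(1)] show ?thesis
  proof eventually_elim
    case (elim y)
    have "v y + ereal (g y) \<le> ereal d + ereal (g y)"
      using elim by (intro add_mono) auto
    then show ?case using elim by simp
  qed
qed

section \<open>The maximum principle on complex lines\<close>

text \<open>
  At a maximum along the line, the submean inequality for \<open>v\<close> on a circle of small radius \<open>r\<close>
  would fail. The hypothesis \<open>lap\<close> removes the second order term of \<open>u\<close> from the mean. The Taylor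
  remainder is kept below \<open>\<epsilon>/2 r\<^sup>2\<close>, half of the gain \<open>\<epsilon> r\<^sup>2\<close> from the quadratic perturbation; the centre
  \<open>q\<close> of the latter only affects the terms of first order.
\<close>

lemma no_maximum_along_line:
  fixes u :: "'a::chilbert_space \<Rightarrow> real"
  assumes "open \<Omega>" "C2_on \<Omega> u" "open G" "z \<in> G" "z \<in> \<Omega>" "psh_on G v"
    and lap: "D2 u z e e + D2 u z (\<i> *\<^sub>C e) (\<i> *\<^sub>C e) = 0"
    and e: "norm e = 1" and \<epsilon>: "\<epsilon> > 0" and vz: "v z = ereal p"
  obtains c where "z + c *\<^sub>C e \<in> G"
    "v z + ereal (\<epsilon> * (norm (z - q))\<^sup>2 - u z)
       < v (z + c *\<^sub>C e) + ereal (\<epsilon> * (norm (z + c *\<^sub>C e - q))\<^sup>2 - u (z + c *\<^sub>C e))"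
proof (rule ccontr)
  assume "\<not> thesis"
  with that have no: "\<not> v z + ereal (\<epsilon> * (norm (z - q))\<^sup>2 - u z)
       < v (z + c *\<^sub>C e) + ereal (\<epsilon> * (norm (z + c *\<^sub>C e - q))\<^sup>2 - u (z + c *\<^sub>C e))"
    if c: "z + c *\<^sub>C e \<in> G" for c
    using c by blast
  have max: "v (z + c *\<^sub>C e) + ereal (\<epsilon> * (norm (z + c *\<^sub>C e - q))\<^sup>2 - u (z + c *\<^sub>C e))
      \<le> ereal (p + \<epsilon> * (norm (z - q))\<^sup>2 - u z)" if "z + c *\<^sub>C e \<in> G" for c
    using no[OF that] by (simp add: vz not_less add_diff_eq)
  obtain \<delta>1 where \<delta>1: "\<delta>1 > 0" "\<And>h. norm h < \<delta>1 \<Longrightarrow>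
      u (z + h) \<le> u z + fderiv u z h + D2 u z h h / 2 + \<epsilon> / 2 * (norm h)\<^sup>2"
    using second_order_taylor_upper[OF assms(1,5,2), of "\<epsilon> / 2"] \<epsilon> by auto
  obtain \<delta>2 where \<delta>2: "\<delta>2 > 0" "ball z \<delta>2 \<subseteq> G"
    using assms open_contains_ball by blast
  define r where "r = min \<delta>1 \<delta>2 / 2"
  have r: "r > 0" "r < \<delta>1" "r < \<delta>2" using \<delta>1 \<delta>2 by (auto simp: r_def)
  define h where "h = r *\<^sub>R e"
  have nh: "norm h = r" using r e by (simp add: h_def)
  have in_G: "z + c *\<^sub>C h \<in> G" if "cmod c \<le> 1" for c
  proof -
    have "norm (c *\<^sub>C h) \<le> r"
      using that r by (simp add: norm_scaleC nh mult_left_le_one_le)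
    then show ?thesis using \<delta>2 r by (auto simp: subset_iff dist_norm)
  qed
  have D2h: "D2 u z (\<i> *\<^sub>C h) (\<i> *\<^sub>C h) = - D2 u z h h"
  proof -
    have "\<i> *\<^sub>C h = r *\<^sub>R (\<i> *\<^sub>C e)"
      by (simp add: h_def scaleR_scaleC scaleC_scaleC mult.commute)
    moreover have "D2 u z (\<i> *\<^sub>C e) (\<i> *\<^sub>C e) = - D2 u z e e" using lap by simp
    ultimately show ?thesis
      by (simp add: h_def D2_def blinfun.scaleR_left blinfun.scaleR_right)
  qed
  \<comment> \<open>The Fourier coefficients of the upper bound for \<open>v\<close> on the circle.\<close>
  define a where "a = fderiv u z h - 2 * \<epsilon> * inner (z - q) h"
  define b where "b = fderiv u z (\<i> *\<^sub>C h) - 2 * \<epsilon> * inner (z - q) (\<i> *\<^sub>C h)"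
  define d where "d = D2 u z h (\<i> *\<^sub>C h) + D2 u z (\<i> *\<^sub>C h) h"
  have "v (z + cis \<theta> *\<^sub>C h) \<le> ereal ((p - \<epsilon> / 2 * r\<^sup>2) + a * cos \<theta> + b * sin \<theta>
       + D2 u z h h / 2 * cos (2 * \<theta>) + d / 4 * sin (2 * \<theta>))" for \<theta>
  proof -
    define k where "k = cis \<theta> *\<^sub>C h"
    have nk: "norm k = r" by (simp add: k_def norm_scaleC nh)
    have k_eq: "k = cos \<theta> *\<^sub>R h + sin \<theta> *\<^sub>R (\<i> *\<^sub>C h)" by (simp add: k_def cis_scaleC)
    have k_e: "k = (cis \<theta> * complex_of_real r) *\<^sub>C e"
      by (simp add: k_def h_def scaleR_scaleC scaleC_scaleC)
    have "z + k \<in> G" unfolding k_def by (rule in_G) simp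
    then have "v (z + k) + ereal (\<epsilon> * (norm (z + k - q))\<^sup>2 - u (z + k))
        \<le> ereal (p + \<epsilon> * (norm (z - q))\<^sup>2 - u z)"
      using max[of "cis \<theta> * complex_of_real r"] by (simp add: k_e)
    then have "v (z + k) \<le> ereal (p + \<epsilon> * (norm (z - q))\<^sup>2 - u z - (\<epsilon> * (norm (z + k - q))\<^sup>2 - u (z + k)))"
      by (cases "v (z + k)") auto
    also have "\<dots> \<le> ereal (p + \<epsilon> * (norm (z - q))\<^sup>2 - \<epsilon> * (norm (z + k - q))\<^sup>2
        + fderiv u z k + D2 u z k k / 2 + \<epsilon> / 2 * r\<^sup>2)"
      using \<delta>1(2)[of k] nk r by simp
    also have "(norm (z + k - q))\<^sup>2 = (norm (z - q))\<^sup>2 + 2 * inner (z - q) k + r\<^sup>2"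
    proof -
      have "z + k - q = (z - q) + k" by simp
      then show ?thesis
        unfolding nk[symmetric] by (simp only: power2_norm_eq_inner inner_add_left inner_add_right)
           (simp add: inner_commute)
    qed
    also have "D2 u z k k = D2 u z h h * cos (2 * \<theta>) + d / 2 * sin (2 * \<theta>)"
      unfolding cos_double sin_double
      using D2h
      by (simp add: k_eq d_def D2_def blinfun.add_left blinfun.add_right
          blinfun.scaleR_left blinfun.scaleR_right power2_eq_square algebra_simps)
    also have "fderiv u z k = cos \<theta> * fderiv u z h + sin \<theta> * fderiv u z (\<i> *\<^sub>C h)"
      by (simp add: k_eq blinfun.add_right blinfun.scaleR_right)
    also have "inner (z - q) k = cos \<theta> * inner (z - q) h + sin \<theta> * inner (z - q) (\<i> *\<^sub>C h)"
      by (simp add: k_eq inner_add_right)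
    finally show ?thesis
      by (simp add: k_def a_def b_def algebra_simps add_divide_distrib)
  qed
  then have "circle_mean v z h \<le> ereal (p - \<epsilon> / 2 * r\<^sup>2)"
    by (rule circle_mean_le_trigonometric)
  moreover have "v z \<le> circle_mean v z h"
    using \<open>psh_on G v\<close> \<open>z \<in> G\<close> in_G unfolding psh_on_def by blast
  ultimately have "p \<le> p - \<epsilon> / 2 * r\<^sup>2"
    using vz by (metis ereal_less_eq(3) order_trans)
  then show False using r \<epsilon> by (simp add: mult_le_0_iff)
qed

text \<open>
  Closed bounded subsets of \<open>H\<close> need not be compact, so the maximum is taken over the closed
  slice \<open>K\<close> of \<open>G\<close> by the complex line through \<open>z0\<close> in direction \<open>e\<close>.
\<close>

lemma psh_le_of_boundary_le:
  fixes u :: "'a::chilbert_space \<Rightarrow> real"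
  assumes "open \<Omega>" "C2_on \<Omega> u"
    and lap: "\<And>a. a \<in> \<Omega> \<Longrightarrow> D2 u a e e + D2 u a (\<i> *\<^sub>C e) (\<i> *\<^sub>C e) = 0" and e: "norm e = 1"
    and G: "open G" "bounded G" "closure G \<subseteq> \<Omega>" and v: "psh_on G v"
    and bd: "\<And>\<xi>. \<xi> \<in> frontier G \<Longrightarrow> Limsup (at \<xi> within G) v \<le> u \<xi>"
    and z0: "z0 \<in> G"
  shows "v z0 \<le> u z0"
proof (rule ccontr)
  assume "\<not> ?thesis"
  then have "ereal (u z0) < v z0" by simp
  moreover have "v z0 < \<infinity>" using v z0 unfolding psh_on_def by blast
  ultimately obtain p0 where p0: "v z0 = ereal p0" "u z0 < p0"
    by (cases "v z0") auto
  obtain R0 where "closure G \<subseteq> cball z0 R0"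
    using bounded_any_center[of "closure G" z0] G(2) by (auto simp: subset_iff)
  then obtain R where R: "R \<ge> 1" "closure G \<subseteq> cball z0 R"
    by (metis cball_subset_cball_iff max.cobounded1 max.cobounded2 order_trans subset_cball)
  \<comment> \<open>Small enough that the perturbation stays below the excess \<open>p0 - u z0\<close> on the closure of \<open>G\<close>.\<close>
  define \<epsilon> where "\<epsilon> = (p0 - u z0) / (2 * R\<^sup>2)"
  have \<epsilon>: "\<epsilon> > 0" "\<epsilon> * R\<^sup>2 < p0 - u z0"
    using R p0 by (auto simp: \<epsilon>_def)
  define V where "V z = (if z \<in> G then v z else ereal (u z))" for z
  define g where "g z = \<epsilon> * (norm (z - z0))\<^sup>2 - u z" for z
  define K where "K = closure G \<inter> (\<lambda>c. z0 + c *\<^sub>C e) ` cball 0 R"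
  have cu: "continuous_on (closure G) u"
    using assms(2) G(3) unfolding C2_on_def
    by (meson continuous_at_imp_continuous_on differentiable_imp_continuous_within subsetD)
  have GK: "G \<subseteq> closure G" by (rule closure_subset)
  have "compact K"
  proof -
    have "continuous_on (cball 0 R) (\<lambda>c. z0 + c *\<^sub>C e)"
    proof (rule continuous_on_iff[THEN iffD2], intro ballI allI impI)
      fix x \<eta> assume "(\<eta>::real) > 0"
      have "dist (z0 + y *\<^sub>C e) (z0 + x *\<^sub>C e) = dist y x" for y
        using norm_scaleC[of "y - x" e] e
        by (simp add: dist_norm complex_vector.scale_left_diff_distrib)
      then show "\<exists>d>0. \<forall>y\<in>cball 0 R. dist y x < d \<longrightarrow> dist (z0 + y *\<^sub>C e) (z0 + x *\<^sub>C e) < \<eta>"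
        using \<open>\<eta> > 0\<close> by auto
    qed
    then show ?thesis
      unfolding K_def by (intro closed_Int_compact compact_continuous_image) auto
  qed
  have "z0 \<in> K"
    using z0 GK R by (auto simp: K_def intro!: image_eqI[of _ _ 0])
  have V_usc: "\<forall>\<^sub>F y in at x within closure G. V y < c" if "x \<in> closure G" "V x < c" for x c
    using usc_extension_by_boundary_values[OF G(1) _ cu bd, of x c] v that
    unfolding V_def psh_on_def by blast
  obtain z where z: "z \<in> K" "\<And>y. y \<in> K \<Longrightarrow> V y + ereal (g y) \<le> V z + ereal (g z)"
  proof (rule usc_attains_max[OF \<open>compact K\<close>, of "\<lambda>y. V y + ereal (g y)"])
    show "K \<noteq> {}" using \<open>z0 \<in> K\<close> by blast
    fix x c assume x: "x \<in> K" "V x + ereal (g x) < c"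
    have "K \<subseteq> closure G" by (auto simp: K_def)
    have "continuous_on (closure G) g"
      unfolding g_def by (intro continuous_intros cu)
    then have "\<forall>\<^sub>F y in at x within closure G. V y + ereal (g y) < c"
      using x \<open>K \<subseteq> closure G\<close>
      by (intro eventually_add_continuous_less V_usc) (auto simp: continuous_on_def)
    then show "\<forall>\<^sub>F y in at x within K. V y + ereal (g y) < c"
      by (rule filter_leD[OF at_le[OF \<open>K \<subseteq> closure G\<close>]])
  qed blast
  have ge: "ereal (p0 - u z0) \<le> V z + ereal (g z)"
    using z(2)[OF \<open>z0 \<in> K\<close>] z0 p0 by (simp add: V_def g_def)
  have "z \<in> closure G" using z by (simp add: K_def)
  \<comment> \<open>On the boundary of \<open>G\<close> only the perturbation is left, and it is too small.\<close>
  have "z \<in> G"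
  proof (rule ccontr)
    assume "z \<notin> G"
    then have "p0 - u z0 \<le> \<epsilon> * (norm (z - z0))\<^sup>2"
      using ge by (simp add: V_def g_def)
    also have "\<dots> \<le> \<epsilon> * R\<^sup>2"
      using \<epsilon> R \<open>z \<in> closure G\<close> by (intro mult_left_mono power_mono) (auto simp: dist_norm norm_minus_commute)
    finally show False using \<epsilon> by simp
  qed
  have "v z < \<infinity>" using v \<open>z \<in> G\<close> unfolding psh_on_def by blast
  then obtain p where p: "v z = ereal p"
    using ge \<open>z \<in> G\<close> by (cases "v z") (auto simp: V_def)
  obtain c where c: "z + c *\<^sub>C e \<in> G"
    "v z + ereal (g z) < v (z + c *\<^sub>C e) + ereal (g (z + c *\<^sub>C e))"
    using no_maximum_along_line[OF assms(1,2) G(1) \<open>z \<in> G\<close> _ v lap e \<epsilon>(1) p, of z0]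
      \<open>z \<in> closure G\<close> G(3) unfolding g_def by blast
  have "z + c *\<^sub>C e \<in> K"
  proof -
    obtain c0 where "z = z0 + c0 *\<^sub>C e" using z by (auto simp: K_def)
    then have eq: "z + c *\<^sub>C e = z0 + (c0 + c) *\<^sub>C e" by (simp add: scaleC_add_left)
    have "z + c *\<^sub>C e \<in> closure G" using c GK by blast
    moreover from this have "dist z0 (z + c *\<^sub>C e) \<le> R" using R by auto
    then have "cmod (c0 + c) \<le> R"
      unfolding eq using norm_scaleC[of "c0 + c" e] e by (simp add: dist_norm)
    ultimately show ?thesis unfolding K_def using eq by (auto intro!: image_eqI[of _ _ "c0 + c"])
  qed
  from z(2)[OF this] show False
    using c \<open>z \<in> G\<close> by (simp add: V_def)
qed

theorem proposition4p7:
  fixes \<Omega> :: "'a::chilbert_space set" and u :: "'a \<Rightarrow> real" and E :: "'a set"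
  assumes "open \<Omega>" and "connected \<Omega>" and "\<Omega> \<noteq> {}"
    and "psh_on \<Omega> (\<lambda>z. ereal (u z))" and "C2_on \<Omega> u"
    and "csubspace E" and "closed E" and "E \<noteq> UNIV"
    and "\<forall>a\<in>\<Omega>. range (levi_op u a) \<subseteq> E"
  shows "maximal_psh_on \<Omega> (\<lambda>z. ereal (u z))"
proof -
  have "subspace E"
    using \<open>csubspace E\<close> unfolding complex_vector.subspace_def subspace_def
    by (simp add: scaleR_scaleC)
  then obtain w where w: "w \<noteq> 0" "\<And>y. y \<in> E \<Longrightarrow> inner y w = 0"
    using exists_nonzero_orthogonal[OF _ assms(7,8)] by blast
  define e where "e = w /\<^sub>R norm w"
  have e: "norm e = 1" "\<And>y. y \<in> E \<Longrightarrow> inner y e = 0"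
    using w by (auto simp: e_def)
  \<comment> \<open>The Laplacian along \<open>e\<close> is four times the real part of the Levi form at \<open>(e, e)\<close>, which is the
    real inner product of \<open>levi_op u a e\<close> with \<open>e\<close>.\<close>
  have lap: "D2 u a e e + D2 u a (\<i> *\<^sub>C e) (\<i> *\<^sub>C e) = 0" if "a \<in> \<Omega>" for a
  proof -
    have "levi_op u a e \<in> E" using assms(9) that by blast
    then have "Re (levi_form u a e e) = 0"
      using e(2) by (simp add: inner_eq_Re_cinner flip: cinner_levi_op)
    then show ?thesis by (simp add: levi_form_def)
  qed
  show ?thesis
    unfolding maximal_psh_on_def
    using assms(4) psh_le_of_boundary_le[OF assms(1,5) lap e(1)] by blast
qed

end
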